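(* Let $0\le a<b$ be real numbers, let $\alpha\in[0,1]$, let $s\in(0,1]$, let $r$ satisfy $a<r\le b$, and let $p,q>1$ with $\frac1p+\frac1q=1$. Let $f:[a,b]\to\mathbb{R}$ be differentiable on $(a,b)$, with one-sided derivatives $f'(a)$ and $f'(b)$ existing at the endpoints, and suppose $f'\in L_1[a,b]$. If $|f'|^q$ is $s$-convex in the second sense on $[a,b]$, then $$\left|\frac{f(a)+f(r)}{2}-\frac{\Gamma(\alpha+1)}{2(r-a)^{\alpha}}\left[J_{a^+}^{\alpha}f(r)+J_{r^-}^{\alpha}f(a)\right]\right|\le \frac{r-a}{2}\left(\frac{1}{\alpha p+1}\right)^{\frac1p}\left(\frac{|f'(a)|^q+|f'(r)|^q}{s+1}\right)^{\frac1q}.$$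
   Context: A function $g:[a,b]\to\mathbb{R}$ with $[a,b]\subset[0,\infty)$ is $s$-convex in the second sense on $[a,b]$, for a fixed $s\in(0,1]$, if $g(tx+(1-t)y)\le t^s g(x)+(1-t)^s g(y)$ for all $x,y\in[a,b]$ and $t\in[0,1]$. For $\alpha>0$ the Riemann-Liouville fractional integrals are $J_{a^+}^{\alpha}f(x)=\frac{1}{\Gamma(\alpha)}\int_a^x (x-t)^{\alpha-1}f(t)\,dt$ for $x>a$, and $J_{r^-}^{\alpha}f(x)=\frac{1}{\Gamma(\alpha)}\int_x^r (t-x)^{\alpha-1}f(t)\,dt$ for $x<r$, where $\Gamma$ is the Gamma function; by convention $J_{a^+}^{0}f(x)=J_{r^-}^{0}f(x)=f(x)$. *)

theory Defs
  imports "HOL-Analysis.Analysis"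
begin

definition s_convex_second :: "real \<Rightarrow> real \<Rightarrow> real \<Rightarrow> (real \<Rightarrow> real) \<Rightarrow> bool" where
  "s_convex_second s a b g \<longleftrightarrow>
     0 < s \<and> s \<le> 1 \<and> {a..b} \<subseteq> {0..} \<and>
     (\<forall>x\<in>{a..b}. \<forall>y\<in>{a..b}. \<forall>t\<in>{0..1}.
        g (t * x + (1 - t) * y) \<le> t powr s * g x + (1 - t) powr s * g y)"

text \<open>The two Riemann-Liouville integrals are meant for order \<open>\<alpha> \<ge> 0\<close> and for \<open>x > a\<close>,
  respectively \<open>x < r\<close>. At the endpoint \<open>t = x\<close> the kernel is 0, because \<open>0 powr c = 0\<close> for every \<open>c\<close>;
  this single point does not affect the integral.\<close>

definition RL_left :: "real \<Rightarrow> real \<Rightarrow> (real \<Rightarrow> real) \<Rightarrow> real \<Rightarrow> real" where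
  "RL_left a \<alpha> f x =
     (if \<alpha> = 0 then f x
      else 1 / Gamma \<alpha> * (LINT t:{a..x}|lebesgue. (x - t) powr (\<alpha> - 1) * f t))"

definition RL_right :: "real \<Rightarrow> real \<Rightarrow> (real \<Rightarrow> real) \<Rightarrow> real \<Rightarrow> real" where
  "RL_right r \<alpha> f x =
     (if \<alpha> = 0 then f x
      else 1 / Gamma \<alpha> * (LINT t:{x..r}|lebesgue. (t - x) powr (\<alpha> - 1) * f t))"

end

theory Submission
  imports Defs
begin

text \<open>
  For \<open>\<alpha> = 0\<close> the left-hand side vanishes, because both fractional integrals are values of \<open>f\<close>. For
  \<open>\<alpha> > 0\<close>, differentiate \<open>w f\<close> on \<open>[a, r]\<close>, where \<open>w x = (r - x) powr \<alpha> - (x - a) powr \<alpha>\<close>. The term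
  \<open>w' f\<close> carries, up to a factor \<open>- \<alpha>\<close>, exactly the two singular Riemann-Liouville kernels, and the boundary
  values of \<open>w f\<close> give the trapezoid term \<open>f a + f r\<close>. Hence the quantity to be estimated is, up to
  the factor \<open>- 1 / (2 * (r - a) powr \<alpha>)\<close>, the integral of \<open>w f'\<close>
  (\<open>trapezoid_RL_identity\<close>).

  Both factors have explicit pointwise majorants. Since \<open>\<alpha> \<le> 1\<close>, the power function is
  \<open>\<alpha>\<close>-Hoelder with constant 1, so \<open>\<bar>w x\<bar> \<le> \<bar>(r - x) - (x - a)\<bar> powr \<alpha>\<close> (\<open>abs_powr_diff_le\<close>);
  and \<open>s\<close>-convexity bounds \<open>\<bar>f' x\<bar> powr q\<close> by a combination of its values at \<open>a\<close> and \<open>r\<close>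
  (\<open>s_convex_second_le_chord\<close>). Hoelder's inequality applied to these majorants
  (\<open>Hoelder_integral_bound\<close>) leaves only integrals of powers of affine functions. They are
  computed in closed form and produce the factors \<open>1 / (\<alpha> * p + 1)\<close> and \<open>1 / (s + 1)\<close>.
\<close>

section \<open>Differences of real powers\<close>

text \<open>With \<open>z = x + y\<close>, the fractions \<open>x / z\<close> and \<open>y / z\<close> lie in the unit interval and add up to 1;
  raising a number of the unit interval to a power \<open>c \<le> 1\<close> does not decrease it.\<close>

lemma powr_add_subadditive:
  fixes x y c :: real
  assumes "0 \<le> x" "0 \<le> y" "0 \<le> c" "c \<le> 1"
  shows "(x + y) powr c \<le> x powr c + y powr c"
proof (cases "x + y = 0")
  case True
  then show ?thesis by simp
next
  case False
  define z where "z = x + y"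
  have z: "0 < z" using False assms by (simp add: z_def)
  have *: "w / z \<le> w powr c / z powr c" if "0 \<le> w" "w \<le> z" for w
    using powr_mono'[of c 1 "w / z"] that z assms by (simp add: powr_divide)
  have "1 = x / z + y / z"
    using z by (simp add: z_def flip: add_divide_distrib)
  also have "\<dots> \<le> x powr c / z powr c + y powr c / z powr c"
    using assms by (intro add_mono *) (auto simp: z_def)
  also have "\<dots> = (x powr c + y powr c) / (x + y) powr c"
    by (simp add: z_def add_divide_distrib)
  finally show ?thesis
    using z by (simp add: z_def)
qed

lemma abs_powr_diff_le:
  fixes x y c :: real
  assumes "0 \<le> x" "0 \<le> y" "0 \<le> c" "c \<le> 1"
  shows "\<bar>x powr c - y powr c\<bar> \<le> \<bar>x - y\<bar> powr c"
proof (rule linorder_le_cases[of x y])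
  assume "x \<le> y"
  then show ?thesis
    using powr_add_subadditive[of x "y - x" c] powr_mono2[of c x y] assms by simp
next
  assume "y \<le> x"
  then show ?thesis
    using powr_add_subadditive[of y "x - y" c] powr_mono2[of c y x] assms by simp
qed

section \<open>Integrals of powers of affine functions\<close>

text \<open>For \<open>c < 0\<close> the integrand is unbounded, but the antiderivative is continuous up to the singular
  endpoint because \<open>c + 1 > 0\<close>, so the fundamental theorem of calculus still applies.\<close>

lemma has_integral_powr_left_endpoint:
  fixes a b c :: real
  assumes "a \<le> b" "-1 < c"
  shows "((\<lambda>x. (x - a) powr c) has_integral (b - a) powr (c + 1) / (c + 1)) {a..b}"
proof -
  have "((\<lambda>x. (x - a) powr c) has_integral
      (b - a) powr (c + 1) / (c + 1) - (a - a) powr (c + 1) / (c + 1)) {a..b}"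
  proof (rule fundamental_theorem_of_calculus_interior)
    show "continuous_on {a..b} (\<lambda>x. (x - a) powr (c + 1) / (c + 1))"
      using assms by (intro continuous_intros continuous_on_powr') auto
    fix x assume "x \<in> {a<..<b}"
    then show "((\<lambda>x. (x - a) powr (c + 1) / (c + 1)) has_vector_derivative (x - a) powr c) (at x)"
      unfolding has_real_derivative_iff_has_vector_derivative[symmetric]
      using assms by (auto intro!: derivative_eq_intros)
  qed (use assms in simp)
  then show ?thesis by simp
qed

lemma has_integral_powr_right_endpoint:
  fixes a b c :: real
  assumes "a \<le> b" "-1 < c"
  shows "((\<lambda>x. (b - x) powr c) has_integral (b - a) powr (c + 1) / (c + 1)) {a..b}"
proof -
  have "((\<lambda>x. (b - x) powr c) has_integral
      - ((b - b) powr (c + 1) / (c + 1)) - - ((b - a) powr (c + 1) / (c + 1))) {a..b}"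
  proof (rule fundamental_theorem_of_calculus_interior)
    show "continuous_on {a..b} (\<lambda>x. - ((b - x) powr (c + 1) / (c + 1)))"
      using assms by (intro continuous_intros continuous_on_powr') auto
    fix x assume "x \<in> {a<..<b}"
    then show "((\<lambda>x. - ((b - x) powr (c + 1) / (c + 1))) has_vector_derivative (b - x) powr c) (at x)"
      unfolding has_real_derivative_iff_has_vector_derivative[symmetric]
      using assms by (auto intro!: derivative_eq_intros)
  qed (use assms in simp)
  then show ?thesis by simp
qed

text \<open>On either side of the midpoint the integrand is \<open>2 powr c\<close> times a power of the distance to the
  midpoint, so each half contributes the same amount.\<close>

lemma has_integral_powr_abs_centred:
  fixes a b c :: real
  assumes "a \<le> b" "0 \<le> c"
  shows "((\<lambda>x. \<bar>(b - x) - (x - a)\<bar> powr c) has_integral (b - a) powr (c + 1) / (c + 1)) {a..b}"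
proof -
  define m where "m = (a + b) / 2"
  have m: "a \<le> m" "m \<le> b" "m - a = (b - a) / 2" "b - m = (b - a) / 2" "2 * m = a + b"
    using assms by (auto simp: m_def field_simps)
  define I where "I = 2 powr c * (((b - a) / 2) powr (c + 1) / (c + 1))"
  have "((\<lambda>x. \<bar>(b - x) - (x - a)\<bar> powr c) has_integral I) {a..m}"
  proof (rule has_integral_eq)
    show "((\<lambda>x. 2 powr c * (m - x) powr c) has_integral I) {a..m}"
      unfolding I_def
      using has_integral_mult_right[OF has_integral_powr_right_endpoint[of a m c], of "2 powr c"]
        m assms by simp
    show "2 powr c * (m - x) powr c = \<bar>(b - x) - (x - a)\<bar> powr c" if "x \<in> {a..m}" for x
    proof -
      have "\<bar>(b - x) - (x - a)\<bar> = 2 * (m - x)" using that m(5) by (simp add: abs_if)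
      then show ?thesis by (simp only: powr_mult)
    qed
  qed
  moreover have "((\<lambda>x. \<bar>(b - x) - (x - a)\<bar> powr c) has_integral I) {m..b}"
  proof (rule has_integral_eq)
    show "((\<lambda>x. 2 powr c * (x - m) powr c) has_integral I) {m..b}"
      unfolding I_def
      using has_integral_mult_right[OF has_integral_powr_left_endpoint[of m b c], of "2 powr c"]
        m assms by simp
    show "2 powr c * (x - m) powr c = \<bar>(b - x) - (x - a)\<bar> powr c" if "x \<in> {m..b}" for x
    proof -
      have "\<bar>(b - x) - (x - a)\<bar> = 2 * (x - m)" using that m(5) by (simp add: abs_if)
      then show ?thesis by (simp only: powr_mult)
    qed
  qed
  ultimately have "((\<lambda>x. \<bar>(b - x) - (x - a)\<bar> powr c) has_integral I + I) {a..b}"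
    using m by (intro has_integral_combine)
  moreover have "I + I = (b - a) powr (c + 1) / (c + 1)"
  proof -
    have "((b - a) / 2) powr (c + 1) = (b - a) powr (c + 1) / (2 powr c * 2)"
      using assms by (simp add: powr_divide powr_add[of 2])
    then have "I = (b - a) powr (c + 1) / (c + 1) / 2"
      by (simp add: I_def)
    then show ?thesis by (simp only: field_sum_of_halves)
  qed
  ultimately show ?thesis by simp
qed

section \<open>Hoelder's inequality for pointwise majorants\<close>

text \<open>This form suits a product \<open>h\<close> whose factors are known only through pointwise bounds; \<open>A\<close> and
  \<open>B\<close> are the integrals of the \<open>p\<close>-th and \<open>q\<close>-th powers of these bounds. It follows by integrating Young's inequality for
  the normalised factors. Normalising by \<open>A + e\<close> and \<open>B + e\<close> and letting \<open>e\<close> tend to 0 covers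
  the degenerate cases \<open>A = 0\<close> and \<open>B = 0\<close>.\<close>

lemma Hoelder_integral_bound:
  fixes h U V :: "'a::euclidean_space \<Rightarrow> real" and p q A B :: real
  assumes pq: "1 < p" "1 < q" "1 / p + 1 / q = 1"
    and U: "(U has_integral A) S" "\<And>x. x \<in> S \<Longrightarrow> 0 \<le> U x"
    and V: "(V has_integral B) S" "\<And>x. x \<in> S \<Longrightarrow> 0 \<le> V x"
    and h: "h integrable_on S"
    and le: "\<And>x. x \<in> S \<Longrightarrow> \<bar>h x\<bar> \<le> U x powr (1 / p) * V x powr (1 / q)"
  shows "\<bar>integral S h\<bar> \<le> A powr (1 / p) * B powr (1 / q)"
proof -
  have A: "0 \<le> A" and B: "0 \<le> B"
    using has_integral_nonneg U V by blast+
  have eps: "\<bar>integral S h\<bar> \<le> (A + e) powr (1 / p) * (B + e) powr (1 / q)" if "0 < e" for e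
  proof -
    define C where "C = (A + e) powr (1 / p) * (B + e) powr (1 / q)"
    have "0 < C" using A B that by (simp add: C_def)
    define g where "g x = C * (U x / (A + e) / p + V x / (B + e) / q)" for x
    have g: "(g has_integral C * (A / (A + e) / p + B / (B + e) / q)) S"
      unfolding g_def
      by (intro has_integral_mult_right has_integral_add has_integral_divide U V)
    have "\<bar>integral S h\<bar> \<le> integral S g"
    proof (rule Henstock_Kurzweil_Integration.integral_norm_bound_integral[OF h, unfolded real_norm_def])
      show "g integrable_on S" using g by blast
      fix x assume x: "x \<in> S"
      have "U x powr (1 / p) * V x powr (1 / q)
          = C * ((U x / (A + e)) powr (1 / p) * (V x / (B + e)) powr (1 / q))"
        using A B U(2)[OF x] V(2)[OF x] that by (simp add: C_def powr_divide)
      also have "\<dots> \<le> C * (((U x / (A + e)) powr (1 / p)) powr p / p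
          + ((V x / (B + e)) powr (1 / q)) powr q / q)"
        using \<open>0 < C\<close> pq by (intro mult_left_mono Youngs_inequality) auto
      also have "\<dots> = g x"
        using A B U(2)[OF x] V(2)[OF x] that pq by (simp add: g_def powr_powr)
      finally show "\<bar>h x\<bar> \<le> g x"
        using le[OF x] by linarith
    qed
    also have "\<dots> = C * (A / (A + e) / p + B / (B + e) / q)"
      using g by (rule integral_unique)
    also have "\<dots> \<le> C * (1 / p + 1 / q)"
      using A B that pq \<open>0 < C\<close>
      by (intro mult_left_mono add_mono divide_right_mono) auto
    finally show ?thesis using pq by (simp add: C_def)
  qed
  have "((\<lambda>e. (A + e) powr (1 / p) * (B + e) powr (1 / q))
      \<longlongrightarrow> (A + 0) powr (1 / p) * (B + 0) powr (1 / q)) (at_right 0)"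
  proof (intro tendsto_intros tendsto_powr')
    show "A + 0 \<noteq> 0 \<or> 0 < 1 / p \<and> (\<forall>\<^sub>F e in at_right 0. 0 \<le> A + e)"
      using A pq by (auto intro!: eventually_at_right_less[THEN eventually_mono])
    show "B + 0 \<noteq> 0 \<or> 0 < 1 / q \<and> (\<forall>\<^sub>F e in at_right 0. 0 \<le> B + e)"
      using B pq by (auto intro!: eventually_at_right_less[THEN eventually_mono])
  qed
  then have "\<bar>integral S h\<bar> \<le> (A + 0) powr (1 / p) * (B + 0) powr (1 / q)"
  proof (rule tendsto_lowerbound)
    show "\<forall>\<^sub>F e in at_right 0. \<bar>integral S h\<bar> \<le> (A + e) powr (1 / p) * (B + e) powr (1 / q)"
      using eps by (auto intro!: eventually_at_right_less[THEN eventually_mono])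
  qed simp
  then show ?thesis by simp
qed

section \<open>The trapezoid error as an integral of the derivative\<close>

lemma absolutely_integrable_continuous_mult:
  fixes g h :: "real \<Rightarrow> real"
  assumes "continuous_on {a..b} g" "h absolutely_integrable_on {a..b}"
  shows "(\<lambda>x. g x * h x) absolutely_integrable_on {a..b}"
  using assms
  by (intro absolutely_integrable_bounded_measurable_product_real
            continuous_imp_measurable_on_sets_lebesgue)
     (auto intro!: compact_imp_bounded compact_continuous_image)

text \<open>Integration by parts for \<open>w f\<close> with \<open>w x = (r - x) powr \<alpha> - (x - a) powr \<alpha>\<close>. The derivative of \<open>w\<close>
  is singular at both endpoints when \<open>\<alpha> < 1\<close>, but \<open>w f\<close> is continuous on the closed interval. Each kernel
  times \<open>f\<close> is absolutely integrable, so the integral of \<open>w' f\<close> splits into the two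
  Lebesgue integrals that define the fractional integrals.\<close>

lemma trapezoid_RL_identity:
  fixes f f' :: "real \<Rightarrow> real"
  assumes ar: "a < r" and \<alpha>: "0 < \<alpha>"
    and cont: "continuous_on {a..r} f"
    and deriv: "\<And>x. x \<in> {a<..<r} \<Longrightarrow> (f has_real_derivative f' x) (at x)"
    and f': "f' absolutely_integrable_on {a..r}"
  shows "(f a + f r) / 2 -
      Gamma (\<alpha> + 1) / (2 * (r - a) powr \<alpha>) * (RL_left a \<alpha> f r + RL_right r \<alpha> f a)
    = - (1 / (2 * (r - a) powr \<alpha>)) *
        integral {a..r} (\<lambda>x. ((r - x) powr \<alpha> - (x - a) powr \<alpha>) * f' x)"
proof -
  let ?w = "\<lambda>x. (r - x) powr \<alpha> - (x - a) powr \<alpha>"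
  let ?L = "\<lambda>x. (r - x) powr (\<alpha> - 1) * f x" and ?R = "\<lambda>x. (x - a) powr (\<alpha> - 1) * f x"
  have "(\<lambda>x. (r - x) powr (\<alpha> - 1)) absolutely_integrable_on {a..r}"
    using has_integral_powr_right_endpoint[of a r "\<alpha> - 1"] ar \<alpha>
    by (intro nonnegative_absolutely_integrable_1) auto
  from absolutely_integrable_continuous_mult[OF cont this]
  have L: "?L absolutely_integrable_on {a..r}" by (simp add: mult.commute)
  have "(\<lambda>x. (x - a) powr (\<alpha> - 1)) absolutely_integrable_on {a..r}"
    using has_integral_powr_left_endpoint[of a r "\<alpha> - 1"] ar \<alpha>
    by (intro nonnegative_absolutely_integrable_1) auto
  from absolutely_integrable_continuous_mult[OF cont this]
  have R: "?R absolutely_integrable_on {a..r}" by (simp add: mult.commute)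
  have w: "continuous_on {a..r} ?w"
    using \<alpha> by (intro continuous_intros continuous_on_powr') auto
  have W: "(\<lambda>x. ?w x * f' x) integrable_on {a..r}"
    using absolutely_integrable_continuous_mult[OF w f'] set_lebesgue_integral_eq_integral(1) by blast
  define IL IR IW where "IL = integral {a..r} ?L" and "IR = integral {a..r} ?R"
    and "IW = integral {a..r} (\<lambda>x. ?w x * f' x)"
  have "((\<lambda>x. - \<alpha> * (?L x + ?R x) + ?w x * f' x) has_integral ?w r * f r - ?w a * f a) {a..r}"
  proof (rule fundamental_theorem_of_calculus_interior)
    show "continuous_on {a..r} (\<lambda>x. ?w x * f x)"
      using w cont by (rule continuous_on_mult)
    fix x assume x: "x \<in> {a<..<r}"
    show "((\<lambda>x. ?w x * f x) has_vector_derivative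
        - \<alpha> * (?L x + ?R x) + ?w x * f' x) (at x)"
      unfolding has_real_derivative_iff_has_vector_derivative[symmetric]
      using x by (auto intro!: derivative_eq_intros deriv simp: algebra_simps)
  qed (use ar in simp)
  moreover have "((\<lambda>x. - \<alpha> * (?L x + ?R x) + ?w x * f' x) has_integral - \<alpha> * (IL + IR) + IW) {a..r}"
    unfolding IL_def IR_def IW_def
    using set_lebesgue_integral_eq_integral(1)[OF L] set_lebesgue_integral_eq_integral(1)[OF R] W
    by (intro has_integral_add has_integral_mult_right integrable_integral)
  ultimately have "?w r * f r - ?w a * f a = - \<alpha> * (IL + IR) + IW"
    by (rule has_integral_unique)
  then have parts: "\<alpha> * (IL + IR) = (r - a) powr \<alpha> * (f a + f r) + IW"
    by (simp add: algebra_simps)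
  have "Gamma \<alpha> \<noteq> 0" using \<alpha> by (simp add: Gamma_real_pos less_imp_neq[symmetric])
  moreover have "Gamma (\<alpha> + 1) = \<alpha> * Gamma \<alpha>"
    using \<alpha> by (intro Gamma_plus1) (auto elim: nonpos_Ints_cases)
  moreover have "RL_left a \<alpha> f r = IL / Gamma \<alpha>" "RL_right r \<alpha> f a = IR / Gamma \<alpha>"
    using \<alpha> set_lebesgue_integral_eq_integral(2)[OF L] set_lebesgue_integral_eq_integral(2)[OF R]
    by (simp_all add: RL_left_def RL_right_def IL_def IR_def)
  ultimately have "Gamma (\<alpha> + 1) * (RL_left a \<alpha> f r + RL_right r \<alpha> f a) = \<alpha> * (IL + IR)"
    by (simp add: field_simps)
  then have "Gamma (\<alpha> + 1) / (2 * (r - a) powr \<alpha>) * (RL_left a \<alpha> f r + RL_right r \<alpha> f a)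
      = ((r - a) powr \<alpha> * (f a + f r) + IW) / (2 * (r - a) powr \<alpha>)"
    using parts by (simp add: field_simps)
  then show ?thesis
    using ar unfolding IW_def[symmetric] by (simp add: field_simps)
qed

section \<open>The fractional trapezoid inequality\<close>

text \<open>Every \<open>x\<close> in \<open>[a, r]\<close> is the convex combination of \<open>a\<close> and \<open>r\<close> with weights
  \<open>(r - x) / (r - a)\<close> and \<open>(x - a) / (r - a)\<close>.\<close>

lemma s_convex_second_le_chord:
  assumes conv: "s_convex_second s a b g" and "a < r" "r \<le> b" "x \<in> {a..r}"
  shows "g x \<le> ((r - x) powr s * g a + (x - a) powr s * g r) / (r - a) powr s"
proof -
  define t where "t = (r - x) / (r - a)"
  have t: "t \<in> {0..1}" "1 - t = (x - a) / (r - a)"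
    using assms by (auto simp: t_def field_simps)
  have "t * (r - a) = r - x"
    using assms by (simp add: t_def)
  then have x: "t * a + (1 - t) * r = x"
    by (simp add: algebra_simps)
  have "g (t * a + (1 - t) * r) \<le> t powr s * g a + (1 - t) powr s * g r"
    using conv t(1) assms(2-4) unfolding s_convex_second_def by auto
  also have "\<dots> = ((r - x) powr s * g a + (x - a) powr s * g r) / (r - a) powr s"
    unfolding t(2) using assms(2-4) by (simp add: t_def powr_divide add_divide_distrib)
  finally show ?thesis using x by simp
qed

theorem theorem6:
  fixes a b r \<alpha> s p q :: real and f f' :: "real \<Rightarrow> real"
  assumes "0 \<le> a" and "a < b"
    and "0 \<le> \<alpha>" and "\<alpha> \<le> 1"
    and "0 < s" and "s \<le> 1"
    and "a < r" and "r \<le> b"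
    and "1 < p" and "1 < q" and "1 / p + 1 / q = 1"
    and "\<And>x. x \<in> {a<..<b} \<Longrightarrow> (f has_real_derivative f' x) (at x)"
    and "(f has_real_derivative f' a) (at_right a)"
    and "(f has_real_derivative f' b) (at_left b)"
    and "f' absolutely_integrable_on {a..b}"
    and "s_convex_second s a b (\<lambda>x. \<bar>f' x\<bar> powr q)"
  shows "\<bar>(f a + f r) / 2 -
            Gamma (\<alpha> + 1) / (2 * (r - a) powr \<alpha>) * (RL_left a \<alpha> f r + RL_right r \<alpha> f a)\<bar>
         \<le> (r - a) / 2 * (1 / (\<alpha> * p + 1)) powr (1 / p) *
            ((\<bar>f' a\<bar> powr q + \<bar>f' r\<bar> powr q) / (s + 1)) powr (1 / q)"
proof (cases "\<alpha> = 0")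
  case True
  then show ?thesis
    using \<open>a < r\<close> by (simp add: RL_left_def RL_right_def add_divide_distrib add.commute)
next
  case False
  then have \<alpha>: "0 < \<alpha>" using \<open>0 \<le> \<alpha>\<close> by simp
  let ?w = "\<lambda>x. (r - x) powr \<alpha> - (x - a) powr \<alpha>"
  \<comment> \<open>\<open>U\<close> and \<open>V\<close> majorise \<open>\<bar>w\<bar> powr p\<close> and \<open>\<bar>f'\<bar> powr q\<close>; \<open>A\<close> and \<open>B\<close> are their integrals over \<open>[a, r]\<close>.\<close>
  define M where "M = \<bar>f' a\<bar> powr q + \<bar>f' r\<bar> powr q"
  define U where "U x = \<bar>(r - x) - (x - a)\<bar> powr (\<alpha> * p)" for x
  define V where
    "V x = ((r - x) powr s * \<bar>f' a\<bar> powr q + (x - a) powr s * \<bar>f' r\<bar> powr q) / (r - a) powr s" for x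
  define A where "A = (r - a) powr (\<alpha> * p + 1) / (\<alpha> * p + 1)"
  define B where "B = (r - a) * (M / (s + 1))"
  have "continuous (at x within {a..b}) f" if x: "x \<in> {a..b}" for x
  proof -
    consider "x = a" | "x = b" | "x \<in> {a<..<b}" using x by (cases "x = a"; cases "x = b") auto
    then show ?thesis
    proof cases
      case 1
      then show ?thesis
        using assms(2) has_field_derivative_imp_has_derivative[OF assms(13)] has_derivative_continuous
        by (metis at_within_Icc_at_right)
    next
      case 2
      then show ?thesis
        using assms(2) has_field_derivative_imp_has_derivative[OF assms(14)] has_derivative_continuous
        by (metis at_within_Icc_at_left)
    next
      case 3
      then show ?thesis
        using DERIV_isCont[OF assms(12)] continuous_at_imp_continuous_at_within by blast
    qed
  qed
  then have "continuous_on {a..b} f"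
    by (simp add: continuous_on_eq_continuous_within)
  then have cont: "continuous_on {a..r} f"
    by (rule continuous_on_subset) (use \<open>r \<le> b\<close> in auto)
  have f': "f' absolutely_integrable_on {a..r}"
    using absolutely_integrable_on_subcbox[OF assms(15), of a r] assms by simp
  have w: "continuous_on {a..r} ?w"
    using \<alpha> by (intro continuous_intros continuous_on_powr') auto
  have "\<bar>integral {a..r} (\<lambda>x. ?w x * f' x)\<bar> \<le> A powr (1 / p) * B powr (1 / q)"
  proof (rule Hoelder_integral_bound)
    show "(U has_integral A) {a..r}"
      unfolding U_def A_def using assms by (intro has_integral_powr_abs_centred) auto
    have "(V has_integral ((r - a) powr (s + 1) / (s + 1) * \<bar>f' a\<bar> powr q
        + (r - a) powr (s + 1) / (s + 1) * \<bar>f' r\<bar> powr q) / (r - a) powr s) {a..r}"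
      unfolding V_def using assms
      by (intro has_integral_divide has_integral_add has_integral_mult_left
          has_integral_powr_left_endpoint has_integral_powr_right_endpoint) auto
    moreover have "((r - a) powr (s + 1) / (s + 1) * \<bar>f' a\<bar> powr q
        + (r - a) powr (s + 1) / (s + 1) * \<bar>f' r\<bar> powr q) / (r - a) powr s = B"
      using assms by (simp add: B_def M_def powr_add add_divide_distrib distrib_left)
    ultimately show "(V has_integral B) {a..r}" by simp
    show "(\<lambda>x. ?w x * f' x) integrable_on {a..r}"
      using absolutely_integrable_continuous_mult[OF w f'] set_lebesgue_integral_eq_integral(1) by blast
    fix x assume x: "x \<in> {a..r}"
    show "0 \<le> U x" "0 \<le> V x" by (auto simp: U_def V_def)
    have "\<bar>?w x\<bar> \<le> U x powr (1 / p)"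
      using abs_powr_diff_le[of "r - x" "x - a" \<alpha>] x assms by (simp add: U_def powr_powr)
    moreover have "\<bar>f' x\<bar> \<le> V x powr (1 / q)"
    proof -
      have "\<bar>f' x\<bar> powr q \<le> V x"
        unfolding V_def using s_convex_second_le_chord[OF assms(16)] x assms by simp
      then have "(\<bar>f' x\<bar> powr q) powr (1 / q) \<le> V x powr (1 / q)"
        using assms by (intro powr_mono2) auto
      then show ?thesis using assms by (simp add: powr_powr)
    qed
    ultimately show "\<bar>?w x * f' x\<bar> \<le> U x powr (1 / p) * V x powr (1 / q)"
      unfolding abs_mult by (intro mult_mono) auto
  qed (use assms in auto)
  also have "A powr (1 / p) * B powr (1 / q)
      = (r - a) powr ((\<alpha> * p + 1) / p + 1 / q)
        * ((1 / (\<alpha> * p + 1)) powr (1 / p) * (M / (s + 1)) powr (1 / q))"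
    using assms unfolding A_def B_def M_def
    by (simp add: powr_mult powr_divide powr_powr powr_add[of "r - a" "(\<alpha> * p + 1) / p" "1 / q"])
  \<comment> \<open>Conjugacy of the exponents: one full power of \<open>r - a\<close> survives the division by \<open>(r - a) powr \<alpha>\<close>.\<close>
  also have "(\<alpha> * p + 1) / p + 1 / q = \<alpha> + 1"
    using assms by (simp add: add_divide_distrib)
  finally have "\<bar>integral {a..r} (\<lambda>x. ?w x * f' x)\<bar> / (2 * (r - a) powr \<alpha>)
      \<le> (r - a) powr (\<alpha> + 1)
        * ((1 / (\<alpha> * p + 1)) powr (1 / p) * (M / (s + 1)) powr (1 / q)) / (2 * (r - a) powr \<alpha>)"
    by (rule divide_right_mono) simp
  also have "\<dots> = (r - a) / 2 * (1 / (\<alpha> * p + 1)) powr (1 / p) * (M / (s + 1)) powr (1 / q)"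
    using assms by (simp add: powr_add)
  finally show ?thesis
    unfolding M_def
    by (subst trapezoid_RL_identity[OF \<open>a < r\<close> \<alpha> cont _ f'])
       (use assms in \<open>auto simp: abs_mult\<close>)
qed

end
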